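(* Define a colouring of $K_{43}$ by taking $\mathrm{Cyclic}(43)$ and changing the colour from red to blue of the sixteen edges $\mathrm{e}(11,32)$ and $\mathrm{e}(a,a+1)$ for $a\in\{4,5,6,7,13,14,15,16,23,24,30,33,39,40,41\}$ (without deleting vertex $0$). This colouring has exactly four red $K_5$'s, namely those with vertices $$(0,1,2,22,23),\ (0,1,21,22,42),\ (0,1,21,22,23),\ (0,20,21,22,42),$$ and exactly nine blue $K_5$'s, namely those with vertices $$(0,6,11,15,32),\ (0,6,11,17,32),\ (0,8,11,17,32),\ (0,11,28,32,37),\ (0,11,26,32,37),$$ $$(0,11,26,32,35),\ (0,11,15,26,32),\ (0,11,17,26,32),\ (0,11,17,28,32).$$
   Context: $\mathrm{Cyclic}(43)$ is the red/blue edge colouring of the complete graph $K_{43}$ on vertices $0,1,\dots,42$ (labels read modulo $43$) defined as follows. For distinct vertices $a,b$, the distance $\mathrm{d}(a,b)$ is the unique $m\in\{1,\dots,21\}$ with $a-b\equiv m$ or $b-a\equiv m \pmod{43}$. The edge between $a$ and $b$ is red if $\mathrm{d}(a,b)\in\{1,2,7,10,12,13,14,16,18,20,21\}$ and blue if $\mathrm{d}(a,b)\in\{3,4,5,6,8,9,11,15,17,19\}$. Write $\mathrm{e}(u,v)$ for the edge between $u$ and $v$. A red (resp. blue) $K_5$ is a set of five distinct vertices all ten of whose edges are red (resp. blue); tuples denote their underlying sets. *)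

theory Defs
  imports "HOL-Library.Ramsey" "HOL-Number_Theory.Cong"
begin

abbreviation vertices43 :: "int set" where
  "vertices43 \<equiv> {0..42}"

definition cdist :: "int \<Rightarrow> int \<Rightarrow> int" where
  "cdist a b = (THE m. m \<in> {1..21} \<and> ([a - b = m] (mod 43) \<or> [b - a = m] (mod 43)))"

abbreviation (input) edge :: "int \<Rightarrow> int \<Rightarrow> int set" where
  "edge u v \<equiv> {u, v}"

definition red_dists :: "int set" where
  "red_dists = {1, 2, 7, 10, 12, 13, 14, 16, 18, 20, 21}"

definition blue_dists :: "int set" where
  "blue_dists = {3, 4, 5, 6, 8, 9, 11, 15, 17, 19}"

text \<open>A red/blue edge colouring is represented by the pair consisting of its set of red edges
  and its set of blue edges.\<close>

type_synonym colouring = "int set set \<times> int set set"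

definition is_colouring :: "int set \<Rightarrow> colouring \<Rightarrow> bool" where
  "is_colouring V c \<longleftrightarrow> fst c \<inter> snd c = {} \<and> fst c \<union> snd c = [V]\<^bsup>2\<^esup>"

definition Cyclic43 :: colouring where
  "Cyclic43 =
    ({edge a b | a b. a \<in> vertices43 \<and> b \<in> vertices43 \<and> a \<noteq> b \<and> cdist a b \<in> red_dists},
     {edge a b | a b. a \<in> vertices43 \<and> b \<in> vertices43 \<and> a \<noteq> b \<and> cdist a b \<in> blue_dists})"

definition red_to_blue :: "int set set \<Rightarrow> colouring \<Rightarrow> colouring" where
  "red_to_blue F c = (fst c - F, snd c \<union> F)"

definition changed_edges :: "int set set" where
  "changed_edges = insert (edge 11 32)
     {edge a (a + 1) | a. a \<in> {4, 5, 6, 7, 13, 14, 15, 16, 23, 24, 30, 33, 39, 40, 41}}"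

definition modified_colouring :: colouring where
  "modified_colouring = red_to_blue changed_edges Cyclic43"

definition red_K5s :: "int set \<Rightarrow> colouring \<Rightarrow> int set set" where
  "red_K5s V c = {S \<in> [V]\<^bsup>5\<^esup>. clique S (fst c)}"

definition blue_K5s :: "int set \<Rightarrow> colouring \<Rightarrow> int set set" where
  "blue_K5s V c = {S \<in> [V]\<^bsup>5\<^esup>. clique S (snd c)}"

lemma cdist_eqI:
  assumes m: "m \<in> {1..21}" "[a - b = m] (mod 43) \<or> [b - a = m] (mod 43)"
  shows "cdist a b = m"
  unfolding cdist_def
proof (rule the_equality)
  fix k :: int
  assume k: "k \<in> {1..21} \<and> ([a - b = k] (mod 43) \<or> [b - a = k] (mod 43))"
  have "43 dvd k - m \<or> 43 dvd k + m"
  proof -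
    consider "43 dvd a - b - m \<and> 43 dvd a - b - k" | "43 dvd b - a - m \<and> 43 dvd b - a - k"
      | "43 dvd a - b - m \<and> 43 dvd b - a - k" | "43 dvd b - a - m \<and> 43 dvd a - b - k"
      using m(2) k unfolding cong_iff_dvd_diff by blast
    then show ?thesis
    proof cases
      case 1
      moreover have "k - m = (a - b - m) - (a - b - k)" by simp
      ultimately show ?thesis by (metis dvd_diff)
    next
      case 2
      moreover have "k - m = (b - a - m) - (b - a - k)" by simp
      ultimately show ?thesis by (metis dvd_diff)
    next
      case 3
      moreover have "k + m = - ((a - b - m) + (b - a - k))" by simp
      ultimately show ?thesis by (metis dvd_add dvd_minus_iff)
    next
      case 4
      moreover have "k + m = - ((b - a - m) + (a - b - k))" by simp
      ultimately show ?thesis by (metis dvd_add dvd_minus_iff)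
    qed
  qed
  moreover have "\<not> 43 dvd k + m"
    using m(1) k by (auto dest: zdvd_imp_le)
  ultimately have "k mod 43 = m mod 43"
    by (simp add: mod_eq_dvd_iff)
  then show "k = m"
    using m(1) k by simp
qed (use m in auto)

lemma cdist_commute: "cdist a b = cdist b a"
  unfolding cdist_def by (simp add: disj_commute)

lemma cdist_less:
  assumes "a \<in> vertices43" "b \<in> vertices43" "a < b"
  shows "cdist a b = min (b - a) (43 - (b - a))"
proof (rule cdist_eqI)
  show "min (b - a) (43 - (b - a)) \<in> {1..21}"
    using assms by auto
  show "[a - b = min (b - a) (43 - (b - a))] (mod 43) \<or>
        [b - a = min (b - a) (43 - (b - a))] (mod 43)"
  proof (cases "b - a \<le> 21")
    case False
    have "[a - b = 43 - (b - a)] (mod 43)"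
      by (simp add: cong_iff_dvd_diff)
    with False show ?thesis by (simp add: min_def)
  qed (simp add: min_def)
qed

lemma dists_partition:
  "red_dists \<inter> blue_dists = {}" "red_dists \<union> blue_dists = {1..21}"
proof -
  have "{1..21::int} = set [1..21]" by simp
  also have "\<dots> = red_dists \<union> blue_dists"
    by (simp add: upto_rec1 red_dists_def blue_dists_def insert_commute)
  finally show "red_dists \<union> blue_dists = {1..21}" by simp
qed (simp add: red_dists_def blue_dists_def)

lemma cdist_range:
  assumes "a \<in> vertices43" "b \<in> vertices43" "a \<noteq> b"
  shows "cdist a b \<in> {1..21}"
  using assms cdist_less[of a b] cdist_less[of b a] cdist_commute[of a b]
  by (cases a b rule: linorder_cases) (auto simp: min_def)

lemma is_colouring_Cyclic43: "is_colouring vertices43 Cyclic43"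
proof -
  have "fst Cyclic43 \<inter> snd Cyclic43 = {}"
    using dists_partition(1) cdist_commute
    unfolding Cyclic43_def by (fastforce simp: doubleton_eq_iff)
  moreover have "fst Cyclic43 \<union> snd Cyclic43 = [vertices43]\<^bsup>2\<^esup>"
  proof
    show "[vertices43]\<^bsup>2\<^esup> \<subseteq> fst Cyclic43 \<union> snd Cyclic43"
    proof
      fix e assume "e \<in> [vertices43]\<^bsup>2\<^esup>"
      then obtain a b where e: "e = {a, b}" "a \<in> vertices43" "b \<in> vertices43" "a \<noteq> b"
        by (auto simp: nsets_def card_2_iff)
      then have "cdist a b \<in> red_dists \<union> blue_dists"
        using cdist_range dists_partition(2) by simp
      with e show "e \<in> fst Cyclic43 \<union> snd Cyclic43"
        unfolding Cyclic43_def by auto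
    qed
  qed (auto simp: Cyclic43_def nsets_def card_2_iff)
  ultimately show ?thesis by (simp add: is_colouring_def)
qed

lemma changed_edges_eq:
  "changed_edges = insert {11, 32}
     ((\<lambda>a. {a, a + 1}) ` {4, 5, 6, 7, 13, 14, 15, 16, 23, 24, 30, 33, 39, 40, 41})"
  unfolding changed_edges_def Setcompr_eq_image by simp

lemma card_changed_edges: "card changed_edges = 16"
proof -
  define A :: "int set" where "A = {4, 5, 6, 7, 13, 14, 15, 16, 23, 24, 30, 33, 39, 40, 41}"
  have eq: "changed_edges = insert {11, 32} ((\<lambda>a. {a, a + 1}) ` A)"
    unfolding changed_edges_eq A_def ..
  have "inj_on (\<lambda>a::int. {a, a + 1}) A"
    by (auto simp: inj_on_def doubleton_eq_iff)
  then have "card ((\<lambda>a. {a, a + 1}) ` A) = 15"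
    by (subst card_image) (simp_all add: A_def)
  moreover have "{11, 32} \<notin> (\<lambda>a::int. {a, a + 1}) ` A"
    by (auto simp: doubleton_eq_iff)
  moreover have "finite A"
    by (simp add: A_def)
  ultimately show ?thesis
    by (simp add: eq)
qed

lemma changed_edges_red: "changed_edges \<subseteq> fst Cyclic43"
proof -
  have red: "edge a b \<in> fst Cyclic43"
    if "a \<in> vertices43" "b \<in> vertices43" "a \<noteq> b" "cdist a b \<in> red_dists" for a b
    using that unfolding Cyclic43_def by auto
  have "edge 11 32 \<in> fst Cyclic43"
    by (rule red) (simp_all add: cdist_less red_dists_def)
  moreover have "edge a (a + 1) \<in> fst Cyclic43" if "a \<in> {0..41}" for a
    by (rule red) (use that in \<open>simp_all add: cdist_less red_dists_def\<close>)
  moreover have "{4, 5, 6, 7, 13, 14, 15, 16, 23, 24, 30, 33, 39, 40, 41} \<subseteq> {0..41::int}"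
    by simp
  ultimately show ?thesis
    unfolding changed_edges_eq by (simp only: insert_subset image_subset_iff) blast
qed

lemma is_colouring_modified: "is_colouring vertices43 modified_colouring"
  using is_colouring_Cyclic43 changed_edges_red
  unfolding is_colouring_def modified_colouring_def red_to_blue_def by auto

end

theory Submission
  imports Defs
begin

text \<open>Recolouring turns red edges blue, so it can only destroy red \<open>K\<^sub>5\<close>s and only create blue ones.
  The red \<open>K\<^sub>5\<close>s afterwards are the red \<open>K\<^sub>5\<close>s of the cyclic colouring that avoid the sixteen
  edges; and as the cyclic colouring turns out to have no blue \<open>K\<^sub>5\<close>, every blue \<open>K\<^sub>5\<close> afterwards
  contains one of the sixteen edges.

  The cyclic colouring is invariant under translation modulo 43, so its monochromatic \<open>K\<^sub>5\<close>s are
  the translates of those through the vertex 0, and these correspond to the \<open>K\<^sub>4\<close>s inside a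
  neighbourhood of about twenty vertices. A short search finds five red ones, all translates of
  \<open>{0, 1, 2, 22, 23}\<close>, and no blue one. Hence the red \<open>K\<^sub>5\<close>s of the cyclic colouring are the
  translates of that single set (\<open>red_K5s_Cyclic43\<close>). The pattern contains the path 0, 1, 2 and the
  edge from 22 to 23, so that each translate contains three edges of the form \<open>e(a, a + 1)\<close>
  modulo 43. The fifteen changed edges of this form hit all translates but seven; the edge
  \<open>e(11, 32)\<close> hits three of these, and the remaining four contain the vertex 0
  (\<open>red_translates_surviving\<close>).

  On the blue side, the \<open>K\<^sub>5\<close>s through a changed edge come from the triangles in the common blue
  neighbourhood of its ends. There are none for the fifteen edges \<open>e(a, a + 1)\<close>
  (\<open>blue_search_path_edges\<close>), so all the blue \<open>K\<^sub>5\<close>s are due to the edge \<open>e(11, 32)\<close>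
  (\<open>blue_search_11_32\<close>). All these searches are small enough to be carried out by rewriting
  with the defining equations of the search function \<open>cliques\<close>.\<close>

section \<open>Exhaustive search for cliques\<close>

fun cliques :: "('a \<Rightarrow> 'a \<Rightarrow> bool) \<Rightarrow> nat \<Rightarrow> 'a list \<Rightarrow> 'a list list" where
  "cliques R 0 xs = [[]]"
| "cliques R (Suc k) [] = []"
| "cliques R (Suc k) (x # xs) =
     map (Cons x) (cliques R k (filter (R x) xs)) @ cliques R (Suc k) xs"

text \<open>Branching on whether the head of the list belongs to the clique: if it does, the rest lies among
  its neighbours. Distinctness ensures that the head is not counted twice.\<close>

lemma set_cliques:
  assumes "symp R" "distinct xs"
  shows "set ` set (cliques R k xs) = {S. S \<subseteq> set xs \<and> card S = k \<and> pairwise R S}"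
  using assms
proof (induction R k xs rule: cliques.induct)
  case (1 R xs)
  show ?case
    by (auto dest: finite_subset[OF _ finite_set])
next
  case (2 R k)
  show ?case by auto
next
  case (3 R k x xs)
  let ?N = "set (filter (R x) xs)"
  let ?A = "{T. T \<subseteq> ?N \<and> card T = k \<and> pairwise R T}"
  let ?B = "{S. S \<subseteq> set xs \<and> card S = Suc k \<and> pairwise R S}"
  have IH: "set ` set (cliques R k (filter (R x) xs)) = ?A"
      "set ` set (cliques R (Suc k) xs) = ?B"
    using 3 by simp_all
  have x: "x \<notin> set xs"
    using 3 by simp
  have "set ` set (cliques R (Suc k) (x # xs)) =
      insert x ` set ` set (cliques R k (filter (R x) xs)) \<union> set ` set (cliques R (Suc k) xs)"
    by (simp add: image_Un image_image)
  also have "\<dots> = insert x ` ?A \<union> ?B"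
    by (simp only: IH)
  also have "\<dots> = {S. S \<subseteq> set (x # xs) \<and> card S = Suc k \<and> pairwise R S}" (is "_ = ?C")
  proof (intro equalityI subsetI)
    fix S assume "S \<in> insert x ` ?A \<union> ?B"
    then show "S \<in> ?C"
    proof
      assume "S \<in> insert x ` ?A"
      then obtain T where T: "S = insert x T" "T \<subseteq> ?N" "card T = k" "pairwise R T"
        by blast
      moreover have "finite T"
        using T(2) finite_subset by blast
      moreover have "x \<notin> T"
        using T(2) x by auto
      moreover have "\<forall>y\<in>T. R x y \<and> R y x"
        using T(2) \<open>symp R\<close> by (auto dest: sympD)
      ultimately show ?thesis
        by (auto simp: pairwise_insert)
    qed auto
  next
    fix S assume S: "S \<in> ?C"
    show "S \<in> insert x ` ?A \<union> ?B"
    proof (cases "x \<in> S")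
      case True
      have "S - {x} \<in> ?A"
        using S True by (auto simp: pairwise_def card_Diff_singleton_if)
      moreover have "S = insert x (S - {x})"
        using True by blast
      ultimately show ?thesis by blast
    qed (use S in auto)
  qed
  finally show ?case .
qed

text \<open>A search that starts from a prescribed partial clique keeps the evaluation cheap: the
  only candidates left are the common neighbours of the vertices already chosen.\<close>

definition cliques_containing ::
    "('a \<Rightarrow> 'a \<Rightarrow> bool) \<Rightarrow> nat \<Rightarrow> 'a list \<Rightarrow> 'a list \<Rightarrow> 'a list list" where
  "cliques_containing R k us xs =
     map ((@) us) (cliques R k (filter (\<lambda>x. \<forall>u\<in>set us. R u x) xs))"

text \<open>Irreflexivity keeps \<open>us\<close> itself out of the common neighbourhood, so that the union of \<open>us\<close> with
  a clique found there has the full size.\<close>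

lemma set_cliques_containing:
  assumes R: "symp R" "irreflp R"
    and xs: "distinct xs" "distinct us" "set us \<subseteq> set xs"
    and us: "pairwise R (set us)"
  shows "set ` set (cliques_containing R k us xs) =
    {S. S \<subseteq> set xs \<and> card S = length us + k \<and> pairwise R S \<and> set us \<subseteq> S}"
proof -
  let ?N = "set (filter (\<lambda>x. \<forall>u\<in>set us. R u x) xs)"
  let ?A = "{T. T \<subseteq> ?N \<and> card T = k \<and> pairwise R T}"
  have "set ` set (cliques_containing R k us xs) =
      (\<union>) (set us) ` set ` set (cliques R k (filter (\<lambda>x. \<forall>u\<in>set us. R u x) xs))"
    by (simp add: cliques_containing_def image_image)
  also have "\<dots> = (\<union>) (set us) ` ?A"
    using R xs by (subst set_cliques) auto
  also have "\<dots> = {S. S \<subseteq> set xs \<and> card S = length us + k \<and> pairwise R S \<and> set us \<subseteq> S}"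
    (is "_ = ?C")
  proof (intro equalityI subsetI)
    fix S assume "S \<in> (\<union>) (set us) ` ?A"
    then obtain T where T: "S = set us \<union> T" "T \<subseteq> ?N" "card T = k" "pairwise R T"
      by blast
    have "finite T"
      using T(2) finite_subset by blast
    moreover have "set us \<inter> T = {}"
      using T(2) R(2) by (auto dest: irreflpD)
    ultimately have "card S = length us + k"
      using T xs(2) by (simp add: card_Un_disjoint distinct_card)
    moreover have "pairwise R S"
      using T us R(1) unfolding T(1) pairwise_def by (fastforce dest: sympD)
    ultimately show "S \<in> ?C"
      using T xs(3) by auto
  next
    fix S assume S: "S \<in> ?C"
    have "R u x" if "u \<in> set us" "x \<in> S - set us" for u x
      using S that by (intro pairwiseD[of R S]) auto
    with S have "S - set us \<in> ?A"
      using xs(2) by (auto simp: pairwise_def card_Diff_subset distinct_card)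
    moreover have "S = set us \<union> (S - set us)"
      using S by blast
    ultimately show "S \<in> (\<union>) (set us) ` ?A"
      by blast
  qed
  finally show ?thesis .
qed

text \<open>The search works on an adjacency relation, the colour classes are sets of edges; the two have to
  agree only between distinct vertices.\<close>

lemma K5s_eq_pairwise:
  assumes "\<And>a b. a \<in> V \<Longrightarrow> b \<in> V \<Longrightarrow> a \<noteq> b \<Longrightarrow> {a, b} \<in> E \<longleftrightarrow> R a b" "finite V"
  shows "{S \<in> [V]\<^bsup>5\<^esup>. clique S E} = {S. S \<subseteq> V \<and> card S = 5 \<and> pairwise R S}"
  using assms finite_subset[of _ V]
  by (auto simp: nsets_def clique_def pairwise_def subset_iff)

section \<open>Circulant edge sets on 43 vertices\<close>

definition circulant :: "int set \<Rightarrow> int set set" where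
  "circulant D = {edge a b | a b. a \<in> vertices43 \<and> b \<in> vertices43 \<and> a \<noteq> b \<and> cdist a b \<in> D}"

lemma Cyclic43_circulant: "Cyclic43 = (circulant red_dists, circulant blue_dists)"
  by (simp add: Cyclic43_def circulant_def)

lemma edge_in_circulant_iff:
  "{a, b} \<in> circulant D \<longleftrightarrow> a \<in> vertices43 \<and> b \<in> vertices43 \<and> a \<noteq> b \<and> cdist a b \<in> D"
  by (auto simp: circulant_def doubleton_eq_iff cdist_commute[of a b])

text \<open>An evaluable form of \<open>cdist a b \<in> D\<close>: the distance is the smaller of \<open>\<bar>a - b\<bar>\<close> and
  \<open>43 - \<bar>a - b\<bar>\<close>, and the larger of the two exceeds 21 and so lies outside any
  \<open>D \<subseteq> {1..21}\<close>.\<close>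

definition circ_adj :: "int set \<Rightarrow> int \<Rightarrow> int \<Rightarrow> bool" where
  "circ_adj D a b \<longleftrightarrow> \<bar>a - b\<bar> \<in> D \<or> 43 - \<bar>a - b\<bar> \<in> D"

lemma symp_circ_adj: "symp (circ_adj D)"
  by (auto simp: symp_def circ_adj_def abs_minus_commute)

lemma irreflp_circ_adj: "D \<subseteq> {1..21} \<Longrightarrow> irreflp (circ_adj D)"
  by (auto simp: irreflp_def circ_adj_def)

lemma cdist_eq_min:
  assumes "a \<in> vertices43" "b \<in> vertices43" "a \<noteq> b"
  shows "cdist a b = min \<bar>a - b\<bar> (43 - \<bar>a - b\<bar>)"
proof (cases "a < b")
  case True
  then show ?thesis using assms cdist_less[of a b] by simp
next
  case False
  then show ?thesis using assms cdist_less[of b a] by (simp add: cdist_commute[of a b])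
qed

lemma edge_in_circulant_circ_adj:
  assumes "D \<subseteq> {1..21}" "a \<in> vertices43" "b \<in> vertices43" "a \<noteq> b"
  shows "{a, b} \<in> circulant D \<longleftrightarrow> circ_adj D a b"
proof -
  have "\<bar>a - b\<bar> \<notin> D" if "\<bar>a - b\<bar> > 21"
    using that assms(1) by auto
  moreover have "43 - \<bar>a - b\<bar> \<notin> D" if "\<bar>a - b\<bar> \<le> 21"
    using that assms(1) by auto
  ultimately show ?thesis
    using assms(2-4) by (auto simp: edge_in_circulant_iff cdist_eq_min circ_adj_def min_def)
qed

lemma red_blue_dists_range: "red_dists \<subseteq> {1..21}" "blue_dists \<subseteq> {1..21}"
  using dists_partition(2) by auto

lemma circulant_K5s_through_0:
  assumes "D \<subseteq> {1..21}"
  shows "{S \<in> [vertices43]\<^bsup>5\<^esup>. clique S (circulant D) \<and> 0 \<in> S} =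
    set ` set (cliques_containing (circ_adj D) 4 [0] [0..42])"
proof -
  have "{S \<in> [vertices43]\<^bsup>5\<^esup>. clique S (circulant D)} =
      {S. S \<subseteq> vertices43 \<and> card S = 5 \<and> pairwise (circ_adj D) S}"
    using edge_in_circulant_circ_adj[OF assms] by (intro K5s_eq_pairwise) auto
  then show ?thesis
    by (subst set_cliques_containing) (use assms in \<open>auto simp: symp_circ_adj irreflp_circ_adj\<close>)
qed

definition translate :: "int \<Rightarrow> int \<Rightarrow> int" where
  "translate t x = (x + t) mod 43"

lemma translate_in_vertices43: "translate t x \<in> vertices43"
  by (auto simp: translate_def intro: order.trans[OF zless_imp_add1_zle])

lemma translate_translate: "translate s (translate t x) = translate (t + s) x"
  by (simp add: translate_def mod_add_left_eq add.assoc)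

lemma translate_mod: "translate (t mod 43) = translate t"
  by (simp add: fun_eq_iff translate_def mod_add_right_eq)

lemma translate_0: "x \<in> vertices43 \<Longrightarrow> translate 0 x = x"
  by (simp add: translate_def)

lemma translate_minus_image:
  assumes "S \<subseteq> vertices43"
  shows "translate t ` translate (- t) ` S = S"
  using assms by (force simp: image_image translate_translate translate_0)

lemma inj_on_translate: "inj_on (translate t) vertices43"
  by (rule inj_on_inverseI[of _ "translate (- t)"]) (simp add: translate_translate translate_0)

lemma cdist_translate: "cdist (translate t a) (translate t b) = cdist a b"
  by (simp add: cdist_def translate_def cong_def mod_diff_eq)

lemma circulant_K5_translate:
  assumes "S \<in> [vertices43]\<^bsup>5\<^esup>" "clique S (circulant D)"
  shows "translate t ` S \<in> [vertices43]\<^bsup>5\<^esup>" "clique (translate t ` S) (circulant D)"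
proof -
  have S: "S \<subseteq> vertices43" "card S = 5" "finite S"
    using assms(1) by (auto simp: nsets_def)
  have "card (translate t ` S) = 5"
    using S inj_on_subset[OF inj_on_translate] by (simp add: card_image)
  then show "translate t ` S \<in> [vertices43]\<^bsup>5\<^esup>"
    using S(3) translate_in_vertices43 by (auto simp: nsets_def simp del: atLeastAtMost_iff)
  show "clique (translate t ` S) (circulant D)"
    using assms(2) translate_in_vertices43
    by (auto simp: clique_def edge_in_circulant_iff cdist_translate simp del: atLeastAtMost_iff)
qed

text \<open>Translating one of its vertices to 0 carries any clique of a circulant graph to one
  that the search in the neighbourhood of 0 finds.\<close>

lemma circulant_K5_from_0:
  assumes "D \<subseteq> {1..21}" "S \<in> [vertices43]\<^bsup>5\<^esup>" "clique S (circulant D)"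
  obtains v T where "S = translate v ` T"
    "T \<in> set ` set (cliques_containing (circ_adj D) 4 [0] [0..42])"
proof -
  have S: "S \<subseteq> vertices43" "S \<noteq> {}"
    using assms(2) by (auto simp: nsets_def)
  then obtain v where v: "v \<in> S"
    by blast
  have "0 \<in> translate (- v) ` S"
    using v by (force simp: translate_def)
  then have "translate (- v) ` S \<in> set ` set (cliques_containing (circ_adj D) 4 [0] [0..42])"
    using circulant_K5_translate[OF assms(2,3)] circulant_K5s_through_0[OF assms(1)] by blast
  with translate_minus_image[OF S(1)] show ?thesis
    using that by metis
qed

section \<open>Monochromatic \<open>K\<^sub>5\<close>s of the cyclic colouring\<close>

text \<open>The shifts 0, 20, 21, 41 and 42 are the negatives modulo 43 of 0, 23, 22, 2 and 1, the
  elements of the pattern: each of them moves a different vertex of the pattern to 0.\<close>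

lemma red_search:
  "set ` set (cliques_containing (circ_adj red_dists) 4 [0] [0..42]) =
    (\<lambda>t. translate t ` {0, 1, 2, 22, 23}) ` {0, 20, 21, 41, 42}"
  by code_simp

lemma blue_search: "cliques_containing (circ_adj blue_dists) 4 [0] [0..42] = []"
  by code_simp

lemma red_K5s_Cyclic43:
  "red_K5s vertices43 Cyclic43 = (\<lambda>t. translate t ` {0, 1, 2, 22, 23}) ` vertices43"
proof (intro equalityI subsetI)
  fix S assume "S \<in> red_K5s vertices43 Cyclic43"
  then have "S \<in> [vertices43]\<^bsup>5\<^esup>" "clique S (circulant red_dists)"
    by (simp_all add: red_K5s_def Cyclic43_circulant)
  then obtain v T where "S = translate v ` T"
      "T \<in> set ` set (cliques_containing (circ_adj red_dists) 4 [0] [0..42])"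
    by (rule circulant_K5_from_0[OF red_blue_dists_range(1)])
  then obtain t where "S = translate v ` translate t ` {0, 1, 2, 22, 23}"
    unfolding red_search by blast
  also have "\<dots> = translate ((t + v) mod 43) ` {0, 1, 2, 22, 23}"
    by (simp only: image_image translate_translate translate_mod)
  finally show "S \<in> (\<lambda>t. translate t ` {0, 1, 2, 22, 23}) ` vertices43"
    using translate_in_vertices43[of v t] unfolding translate_def by blast
next
  fix S assume "S \<in> (\<lambda>t. translate t ` {0, 1, 2, 22, 23}) ` vertices43"
  then obtain t where t: "S = translate t ` {0, 1, 2, 22, 23}"
    by blast
  have "translate 0 ` {0, 1, 2, 22, 23} \<in>
      {S \<in> [vertices43]\<^bsup>5\<^esup>. clique S (circulant red_dists) \<and> 0 \<in> S}"
    unfolding circulant_K5s_through_0[OF red_blue_dists_range(1)] red_search by blast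
  then have base: "{0, 1, 2, 22, 23} \<in> [vertices43]\<^bsup>5\<^esup>"
      "clique {0, 1, 2, 22, 23} (circulant red_dists)"
    by (simp_all add: translate_0)
  then show "S \<in> red_K5s vertices43 Cyclic43"
    unfolding t red_K5s_def Cyclic43_circulant
    using circulant_K5_translate[OF base] by (simp del: image_insert)
qed

lemma blue_K5s_Cyclic43: "blue_K5s vertices43 Cyclic43 = {}"
proof -
  have False if "S \<in> blue_K5s vertices43 Cyclic43" for S
    using that circulant_K5_from_0[OF red_blue_dists_range(2), of S]
    by (auto simp: blue_K5s_def Cyclic43_circulant blue_search)
  then show ?thesis by blast
qed

section \<open>Recolouring the sixteen edges\<close>

text \<open>Each edge is listed once, with its smaller end first, so that the search can run through the
  edges in executable form.\<close>

definition changed_pairs :: "(int \<times> int) list" where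
  "changed_pairs = (11, 32) #
     map (\<lambda>a. (a, a + 1)) [4, 5, 6, 7, 13, 14, 15, 16, 23, 24, 30, 33, 39, 40, 41]"

lemma changed_edges_pairs: "changed_edges = (\<lambda>(u, v). {u, v}) ` set changed_pairs"
  by (simp add: changed_edges_eq changed_pairs_def)

lemma changed_pairs_vertices:
  "(u, v) \<in> set changed_pairs \<Longrightarrow> u \<in> vertices43 \<and> v \<in> vertices43 \<and> u \<noteq> v"
  by (auto simp: changed_pairs_def)

lemma edge_in_changed_edges:
  "{a, b} \<in> changed_edges \<longleftrightarrow> (a, b) \<in> set changed_pairs \<or> (b, a) \<in> set changed_pairs"
  by (force simp: changed_edges_pairs doubleton_eq_iff)

text \<open>Removing edges from a colour class keeps exactly those cliques that use none of them.\<close>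

lemma red_K5s_modified:
  "red_K5s vertices43 modified_colouring =
    {S \<in> red_K5s vertices43 Cyclic43. \<forall>(u, v)\<in>set changed_pairs. \<not> (u \<in> S \<and> v \<in> S)}"
proof -
  have "clique S (fst Cyclic43 - changed_edges) \<longleftrightarrow>
      clique S (fst Cyclic43) \<and> (\<forall>(u, v)\<in>set changed_pairs. \<not> (u \<in> S \<and> v \<in> S))" for S
    using changed_pairs_vertices unfolding clique_def Diff_iff edge_in_changed_edges by blast
  then show ?thesis
    by (auto simp: red_K5s_def modified_colouring_def red_to_blue_def)
qed

text \<open>A blue clique without a changed edge would already be blue in the cyclic colouring.\<close>

lemma blue_K5_modified_has_changed_edge:
  assumes "S \<in> blue_K5s vertices43 modified_colouring"
  obtains u v where "(u, v) \<in> set changed_pairs" "u \<in> S" "v \<in> S"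
proof -
  have "S \<notin> blue_K5s vertices43 Cyclic43"
    by (simp add: blue_K5s_Cyclic43)
  then have "\<exists>a\<in>S. \<exists>b\<in>S. {a, b} \<in> changed_edges"
    using assms by (auto simp: blue_K5s_def modified_colouring_def red_to_blue_def clique_def)
  then show ?thesis
    using that unfolding edge_in_changed_edges by blast
qed

definition mod_blue_adj :: "int \<Rightarrow> int \<Rightarrow> bool" where
  "mod_blue_adj a b \<longleftrightarrow>
     circ_adj blue_dists a b \<or> (a, b) \<in> set changed_pairs \<or> (b, a) \<in> set changed_pairs"

lemma symp_mod_blue_adj: "symp mod_blue_adj"
  using symp_circ_adj[of blue_dists] by (auto simp: symp_def mod_blue_adj_def)

lemma irreflp_mod_blue_adj: "irreflp mod_blue_adj"
  using irreflp_circ_adj[OF red_blue_dists_range(2)] changed_pairs_vertices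
  by (auto simp: irreflp_def mod_blue_adj_def)

lemma edge_in_modified_blue:
  assumes "a \<in> vertices43" "b \<in> vertices43" "a \<noteq> b"
  shows "{a, b} \<in> snd modified_colouring \<longleftrightarrow> mod_blue_adj a b"
  using edge_in_circulant_circ_adj[OF red_blue_dists_range(2) assms]
  by (simp add: modified_colouring_def red_to_blue_def Cyclic43_circulant mod_blue_adj_def
      edge_in_changed_edges)

lemma blue_K5s_modified_through:
  assumes "(u, v) \<in> set changed_pairs"
  shows "{S \<in> blue_K5s vertices43 modified_colouring. u \<in> S \<and> v \<in> S} =
    set ` set (cliques_containing mod_blue_adj 3 [u, v] [0..42])"
proof -
  have "blue_K5s vertices43 modified_colouring =
      {S. S \<subseteq> vertices43 \<and> card S = 5 \<and> pairwise mod_blue_adj S}"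
    unfolding blue_K5s_def using edge_in_modified_blue by (intro K5s_eq_pairwise) auto
  moreover have "pairwise mod_blue_adj (set [u, v])"
    using assms by (simp add: pairwise_insert mod_blue_adj_def)
  moreover have "distinct [u, v]" "set [u, v] \<subseteq> set [0..42]"
    using changed_pairs_vertices[OF assms] by simp_all
  ultimately show ?thesis
    by (simp add: set_cliques_containing[OF symp_mod_blue_adj irreflp_mod_blue_adj])
qed

lemma blue_K5s_modified:
  "blue_K5s vertices43 modified_colouring =
    (\<Union>(u, v)\<in>set changed_pairs. set ` set (cliques_containing mod_blue_adj 3 [u, v] [0..42]))"
  (is "?L = ?R")
proof -
  have "\<exists>(u, v)\<in>set changed_pairs. u \<in> S \<and> v \<in> S" if "S \<in> ?L" for S
    using that by (rule blue_K5_modified_has_changed_edge) blast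
  then have "?L = (\<Union>(u, v)\<in>set changed_pairs. {S \<in> ?L. u \<in> S \<and> v \<in> S})"
    by fastforce
  also have "\<dots> = ?R"
    by (rule SUP_cong) (simp_all only: split_paired_all prod.case blue_K5s_modified_through)
  finally show ?thesis .
qed

lemma red_translates_surviving:
  "{S \<in> (\<lambda>t. translate t ` {0, 1, 2, 22, 23}) ` vertices43.
      \<forall>(u, v)\<in>set changed_pairs. \<not> (u \<in> S \<and> v \<in> S)} =
    {{0, 1, 2, 22, 23}, {0, 1, 21, 22, 42}, {0, 1, 21, 22, 23}, {0, 20, 21, 22, 42}}"
  by code_simp

lemma blue_search_11_32:
  "set ` set (cliques_containing mod_blue_adj 3 [11, 32] [0..42]) =
    {{0, 6, 11, 15, 32}, {0, 6, 11, 17, 32}, {0, 8, 11, 17, 32},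
     {0, 11, 28, 32, 37}, {0, 11, 26, 32, 37}, {0, 11, 26, 32, 35},
     {0, 11, 15, 26, 32}, {0, 11, 17, 26, 32}, {0, 11, 17, 28, 32}}"
  by code_simp

text \<open>The tail of \<open>changed_pairs\<close> leaves out the pair \<open>(11, 32)\<close>. Although the edges \<open>e(a, a + 1)\<close>
  may combine with one another and with \<open>e(11, 32)\<close>, none of them lies in a blue \<open>K\<^sub>5\<close>.\<close>

lemma blue_search_path_edges:
  "\<forall>(u, v)\<in>set (tl changed_pairs). cliques_containing mod_blue_adj 3 [u, v] [0..42] = []"
  by code_simp

theorem mainTheorem4:
  shows "card (red_K5s vertices43 modified_colouring) = 4 \<and>
    red_K5s vertices43 modified_colouring =
      {{0, 1, 2, 22, 23}, {0, 1, 21, 22, 42}, {0, 1, 21, 22, 23}, {0, 20, 21, 22, 42}} \<and>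
    card (blue_K5s vertices43 modified_colouring) = 9 \<and>
    blue_K5s vertices43 modified_colouring =
      {{0, 6, 11, 15, 32}, {0, 6, 11, 17, 32}, {0, 8, 11, 17, 32},
       {0, 11, 28, 32, 37}, {0, 11, 26, 32, 37}, {0, 11, 26, 32, 35},
       {0, 11, 15, 26, 32}, {0, 11, 17, 26, 32}, {0, 11, 17, 28, 32}}"
    (is "card ?red = 4 \<and> ?red = ?R \<and> card ?blue = 9 \<and> ?blue = ?B")
proof -
  have red: "?red = ?R"
    unfolding red_K5s_modified red_K5s_Cyclic43 by (rule red_translates_surviving)
  have "set changed_pairs = insert (11, 32) (set (tl changed_pairs))"
    by (simp add: changed_pairs_def)
  then have "?blue = set ` set (cliques_containing mod_blue_adj 3 [11, 32] [0..42]) \<union>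
      (\<Union>(u, v)\<in>set (tl changed_pairs).
         set ` set (cliques_containing mod_blue_adj 3 [u, v] [0..42]))"
    unfolding blue_K5s_modified by simp
  moreover have "(\<Union>(u, v)\<in>set (tl changed_pairs).
      set ` set (cliques_containing mod_blue_adj 3 [u, v] [0..42])) = {}"
    using blue_search_path_edges by auto
  ultimately have blue: "?blue = ?B"
    by (simp only: blue_search_11_32 Un_empty_right)
  have "card ?R = 4"
    by code_simp
  moreover have "card ?B = 9"
    by code_simp
  ultimately show ?thesis
    using red blue by simp
qed

end
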